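(* Let $G$ be a finite abelian group, let $f: G \to \mathbb{R}$ be a function and let $S \subseteq \widehat{G}$. The optimization problem \[ \max_{\{h_i\}_{i \in I} \in F_S} \alpha \qquad (\text{where } \alpha \text{ is the number such that } f - \alpha = \textstyle\sum_{i\in I} |h_i|^2) \] is equivalent to the semidefinite program \[ \max_{Q \in \mathbb{C}^{S \times S}} \ \widehat{f}(\chi_0) - \operatorname{trace}(Q) \quad \text{s.t.} \quad \sum_{\chi' \in \widehat{G}} Q_{\chi^{-1}\chi', \chi'} = \widehat{f}(\chi) \ \text{ for all } \chi \in \widehat{G},\ \chi \ne \chi_0, \qquad Q \succeq 0, \] where $\chi_0$ is the identity element of $\widehat{G}$. That is, for every real number $\alpha$, there exists $\{h_i\}_{i\in I} \in F_S$ with $f - \alpha = \sum_{i \in I} |h_i|^2$ if and only if there exists a feasible $Q$ of the semidefinite program with $\widehat{f}(\chi_0) - \operatorname{trace}(Q) = \alpha$.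
   Context: For a finite abelian group $G$, the dual group $\widehat{G}$ is the group of all characters of $G$, i.e. group homomorphisms $\chi: G \to \mathbb{C}^\times$. Every function $h: G \to \mathbb{C}$ has a Fourier expansion $h = \sum_{\chi \in \widehat{G}} \widehat{h}(\chi)\chi$ with $\widehat{h}(\chi) = \frac{1}{|G|}\sum_{g \in G} h(g)\overline{\chi(g)}$, and its support is $\operatorname{supp}(h) = \{\chi \in \widehat{G} : \widehat{h}(\chi) \ne 0\}$. For $S \subseteq \widehat{G}$, \[ F_S = \Big\{ \{h_i\}_{i \in I} : f - \alpha = \sum_{i\in I} |h_i|^2 \text{ for some } \alpha,\ \bigcup_{i \in I} \operatorname{supp}(h_i) \subseteq S \Big\}, \] where $\{h_i\}_{i\in I}$ ranges over finite families of functions $h_i: G \to \mathbb{C}$. The notation $Q \in \mathbb{C}^{S \times S}$ means that $Q$ is a complex matrix of size $|S|$ whose rows and columns are indexed by elements of $S$; entries $Q_{\chi_1,\chi_2}$ with $\chi_1 \notin S$ or $\chi_2 \notin S$ are read as $0$. $Q \succeq 0$ means that $Q$ is Hermitian positive semidefinite. *)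

theory Defs
  imports Complex_Main "HOL-Algebra.Coset"
begin

definition complex_units :: "complex monoid" where
  "complex_units = \<lparr>carrier = UNIV - {0}, mult = (*), one = 1\<rparr>"

(* Characters are functions on the whole type of group elements; restricting to
   extensional homomorphisms makes each character of G occur exactly once. *)
definition dual_group :: "('a, 'b) monoid_scheme \<Rightarrow> ('a \<Rightarrow> complex) monoid" where
  "dual_group G =
     \<lparr>carrier = hom G complex_units \<inter> extensional (carrier G),
      mult = (\<lambda>\<chi> \<psi>. \<lambda>g\<in>carrier G. \<chi> g * \<psi> g),
      one = (\<lambda>g\<in>carrier G. 1)\<rparr>"

definition fourier_coeff ::
  "('a, 'b) monoid_scheme \<Rightarrow> ('a \<Rightarrow> complex) \<Rightarrow> ('a \<Rightarrow> complex) \<Rightarrow> complex" where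
  "fourier_coeff G h \<chi> = 1 / of_nat (order G) * (\<Sum>g\<in>carrier G. h g * cnj (\<chi> g))"

definition fourier_supp ::
  "('a, 'b) monoid_scheme \<Rightarrow> ('a \<Rightarrow> complex) \<Rightarrow> ('a \<Rightarrow> complex) set" where
  "fourier_supp G h = {\<chi> \<in> carrier (dual_group G). fourier_coeff G h \<chi> \<noteq> 0}"

definition sos_certificate ::
  "('a, 'b) monoid_scheme \<Rightarrow> ('a \<Rightarrow> real) \<Rightarrow> real \<Rightarrow> 'i set \<Rightarrow> ('i \<Rightarrow> 'a \<Rightarrow> complex) \<Rightarrow> bool" where
  "sos_certificate G f \<alpha> I h \<longleftrightarrow>
     (\<forall>g\<in>carrier G. f g - \<alpha> = (\<Sum>i\<in>I. (cmod (h i g))\<^sup>2))"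

(* The set F_S. A finite family is a pair (I, h) of a finite index set I and a function h
   on it; index sets of natural numbers realise finite families of every cardinality. *)
definition sos_families ::
  "('a, 'b) monoid_scheme \<Rightarrow> ('a \<Rightarrow> real) \<Rightarrow> ('a \<Rightarrow> complex) set
     \<Rightarrow> (nat set \<times> (nat \<Rightarrow> 'a \<Rightarrow> complex)) set" where
  "sos_families G f S =
     {(I, h). finite I \<and> (\<exists>\<alpha>. sos_certificate G f \<alpha> I h) \<and>
              (\<Union>i\<in>I. fourier_supp G (h i)) \<subseteq> S}"

(* Matrices with rows and columns indexed by S, extended by zero outside S x S. *)
definition matrices_on :: "'s set \<Rightarrow> ('s \<Rightarrow> 's \<Rightarrow> complex) set" where
  "matrices_on S = {Q. \<forall>x y. x \<notin> S \<or> y \<notin> S \<longrightarrow> Q x y = 0}"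

definition trace_on :: "'s set \<Rightarrow> ('s \<Rightarrow> 's \<Rightarrow> complex) \<Rightarrow> complex" where
  "trace_on S Q = (\<Sum>x\<in>S. Q x x)"

(* The quadratic form of a Hermitian matrix is real, so Re loses nothing. *)
definition hermitian_psd_on :: "'s set \<Rightarrow> ('s \<Rightarrow> 's \<Rightarrow> complex) \<Rightarrow> bool" where
  "hermitian_psd_on S Q \<longleftrightarrow>
     (\<forall>x\<in>S. \<forall>y\<in>S. Q y x = cnj (Q x y)) \<and>
     (\<forall>v. 0 \<le> Re (\<Sum>x\<in>S. \<Sum>y\<in>S. cnj (v x) * Q x y * v y))"

definition sdp_feasible ::
  "('a, 'b) monoid_scheme \<Rightarrow> ('a \<Rightarrow> real) \<Rightarrow> ('a \<Rightarrow> complex) set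
     \<Rightarrow> (('a \<Rightarrow> complex) \<Rightarrow> ('a \<Rightarrow> complex) \<Rightarrow> complex) set" where
  "sdp_feasible G f S =
     {Q \<in> matrices_on S.
        (\<forall>\<chi>\<in>carrier (dual_group G). \<chi> \<noteq> \<one>\<^bsub>dual_group G\<^esub> \<longrightarrow>
           (\<Sum>\<chi>'\<in>carrier (dual_group G).
              Q (inv\<^bsub>dual_group G\<^esub> \<chi> \<otimes>\<^bsub>dual_group G\<^esub> \<chi>') \<chi>')
           = fourier_coeff G (\<lambda>g. complex_of_real (f g)) \<chi>) \<and>
        hermitian_psd_on S Q}"

definition sdp_objective ::
  "('a, 'b) monoid_scheme \<Rightarrow> ('a \<Rightarrow> real) \<Rightarrow> ('a \<Rightarrow> complex) set
     \<Rightarrow> (('a \<Rightarrow> complex) \<Rightarrow> ('a \<Rightarrow> complex) \<Rightarrow> complex) \<Rightarrow> complex" where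
  "sdp_objective G f S Q =
     fourier_coeff G (\<lambda>g. complex_of_real (f g)) \<one>\<^bsub>dual_group G\<^esub> - trace_on S Q"

end

theory Submission
  imports Defs "HOL-Algebra.Multiplicative_Group"
begin

text \<open>Expanding \<open>h\<^sub>i = (\<Sum>b\<in>S. w\<^sub>i b * b)\<close> gives \<open>(\<Sum>i. \<bar>h\<^sub>i\<bar>\<^sup>2) = (\<Sum>a\<in>S. \<Sum>b\<in>S. Q a b * a\<^sup>-\<^sup>1 * b)\<close> for the Gram
  matrix \<open>Q a b = (\<Sum>i. cnj (w\<^sub>i a) * w\<^sub>i b)\<close>, and the Gram matrices are exactly the positive semidefinite
  ones. Since the characters form an orthogonal basis of the functions on \<open>G\<close>, the equation
  \<open>f - \<alpha> = (\<Sum>i. \<bar>h\<^sub>i\<bar>\<^sup>2)\<close> may be compared coefficient by coefficient: the nontrivial characters give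
  the linear constraints on \<open>Q\<close>, the trivial one gives the objective. Completeness of the characters
  rests on extending characters from a subgroup one generator at a time.\<close>

section \<open>Positive semidefinite forms and Gram matrices\<close>

text \<open>By Hermitian symmetry the column of \<open>s\<close> is the conjugate of its row, so the
  form is a quadratic polynomial in the single coordinate \<open>v s\<close> and its conjugate,
  which prepares completing the square.\<close>

lemma quadratic_form_insert:
  fixes Q :: "'s \<Rightarrow> 's \<Rightarrow> complex"
  assumes S: "finite S" "s \<notin> S" and herm: "\<And>b. b \<in> S \<Longrightarrow> Q b s = cnj (Q s b)"
  shows "(\<Sum>x\<in>insert s S. \<Sum>y\<in>insert s S. cnj (v x) * Q x y * v y) =
    cnj (v s) * Q s s * v s + cnj (v s) * (\<Sum>b\<in>S. Q s b * v b) + cnj (\<Sum>b\<in>S. Q s b * v b) * v s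
      + (\<Sum>x\<in>S. \<Sum>y\<in>S. cnj (v x) * Q x y * v y)"
proof -
  have "(\<Sum>x\<in>S. cnj (v x) * Q x s * v s) = (\<Sum>b\<in>S. cnj (Q s b * v b) * v s)"
    by (intro sum.cong refl) (simp add: herm)
  also have "\<dots> = cnj (\<Sum>b\<in>S. Q s b * v b) * v s"
    by (simp only: cnj_sum sum_distrib_right)
  finally have col: "(\<Sum>x\<in>S. cnj (v x) * Q x s * v s) = cnj (\<Sum>b\<in>S. Q s b * v b) * v s" .
  have row: "(\<Sum>y\<in>S. cnj (v s) * Q s y * v y) = cnj (v s) * (\<Sum>b\<in>S. Q s b * v b)"
    by (simp only: mult.assoc sum_distrib_left)
  show ?thesis
    by (simp only: sum.insert[OF S] sum.distrib row col add.assoc add.left_commute)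
qed

text \<open>With the sum over \<open>i\<close> outermost, the double sum factors into a number times
  its conjugate. An arbitrary \<open>v\<close> gives positive semidefiniteness; the vector
  \<open>v b = b g\<close> evaluates a sum of squares at \<open>g\<close>.\<close>

lemma quadratic_form_gram:
  "(\<Sum>a\<in>S. \<Sum>b\<in>S. (\<Sum>i\<in>I. cnj (w i a) * w i b) * (cnj (v a) * v b))
    = complex_of_real (\<Sum>i\<in>I. (cmod (\<Sum>b\<in>S. w i b * v b))\<^sup>2)"
proof -
  have "(\<Sum>a\<in>S. \<Sum>b\<in>S. (\<Sum>i\<in>I. cnj (w i a) * w i b) * (cnj (v a) * v b))
      = (\<Sum>a\<in>S. \<Sum>b\<in>S. \<Sum>i\<in>I. (w i b * v b) * cnj (w i a * v a))"
    unfolding sum_distrib_right by (intro sum.cong refl) (simp add: mult_ac)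
  also have "\<dots> = (\<Sum>b\<in>S. \<Sum>a\<in>S. \<Sum>i\<in>I. (w i b * v b) * cnj (w i a * v a))"
    by (rule sum.swap)
  also have "\<dots> = (\<Sum>b\<in>S. \<Sum>i\<in>I. \<Sum>a\<in>S. (w i b * v b) * cnj (w i a * v a))"
    by (intro sum.cong refl) (rule sum.swap)
  also have "\<dots> = (\<Sum>i\<in>I. \<Sum>b\<in>S. \<Sum>a\<in>S. (w i b * v b) * cnj (w i a * v a))"
    by (rule sum.swap)
  also have "\<dots> = (\<Sum>i\<in>I. complex_of_real ((cmod (\<Sum>b\<in>S. w i b * v b))\<^sup>2))"
    by (intro sum.cong refl) (simp only: complex_norm_square cnj_sum sum_product)
  finally show ?thesis by simp
qed

lemma hermitian_psd_on_gram:
  assumes "\<And>a b. a \<in> S \<Longrightarrow> b \<in> S \<Longrightarrow> Q a b = (\<Sum>i\<in>I. cnj (w i a) * w i b)"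
  shows "hermitian_psd_on S Q"
  unfolding hermitian_psd_on_def
proof (intro conjI ballI allI)
  show "Q b a = cnj (Q a b)" if "a \<in> S" "b \<in> S" for a b
    using that by (simp add: assms mult.commute)
  fix v
  have "(\<Sum>a\<in>S. \<Sum>b\<in>S. cnj (v a) * Q a b * v b)
      = (\<Sum>a\<in>S. \<Sum>b\<in>S. (\<Sum>i\<in>I. cnj (w i a) * w i b) * (cnj (v a) * v b))"
    by (intro sum.cong refl) (simp only: assms mult_ac)
  then show "0 \<le> Re (\<Sum>a\<in>S. \<Sum>b\<in>S. cnj (v a) * Q a b * v b)"
    by (simp only: quadratic_form_gram Re_complex_of_real) (simp add: sum_nonneg)
qed

text \<open>In the induction step a row of the matrix is split off as a rank-one summand, leaving the Schur
  complement. If the diagonal entry vanishes, so does its row, and \<open>x / 0 = 0\<close> makes the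
  same formulas correct.\<close>

lemma hermitian_psd_on_decomposition:
  fixes Q :: "'s \<Rightarrow> 's \<Rightarrow> complex"
  assumes "finite S" "hermitian_psd_on S Q"
  shows "\<exists>(n::nat) v. \<forall>a\<in>S. \<forall>b\<in>S. Q a b = (\<Sum>i<n. cnj (v i a) * v i b)"
  using assms
proof (induction S arbitrary: Q rule: finite_induct)
  case empty
  show ?case by simp
next
  case (insert s S)
  have herm: "Q y x = cnj (Q x y)" if "x \<in> insert s S" "y \<in> insert s S" for x y
    using insert.prems that unfolding hermitian_psd_on_def by blast
  define d where "d = Re (Q s s)"
  have d: "Q s s = of_real d"
    using herm[of s s] by (simp add: d_def complex_eq_iff)
  define L where "L v = (\<Sum>b\<in>S. Q s b * v b)" for v
  define q where "q v = (\<Sum>x\<in>S. \<Sum>y\<in>S. cnj (v x) * Q x y * v y)" for v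
  \<comment> \<open>The form at \<open>v\<close> with its \<open>s\<close>-coordinate replaced by
    \<open>t\<close>; the later inequalities come from choices of \<open>t\<close> and
    \<open>v\<close>.\<close>
  have pos: "0 \<le> Re (cnj t * of_real d * t + cnj t * L v + cnj (L v) * t + q v)" for v t
  proof -
    let ?w = "v(s := t)"
    have "0 \<le> Re (\<Sum>x\<in>insert s S. \<Sum>y\<in>insert s S. cnj (?w x) * Q x y * ?w y)"
      using insert.prems unfolding hermitian_psd_on_def by blast
    also have "(\<Sum>x\<in>insert s S. \<Sum>y\<in>insert s S. cnj (?w x) * Q x y * ?w y) =
        cnj (?w s) * Q s s * ?w s + cnj (?w s) * L ?w + cnj (L ?w) * ?w s + q ?w"
      unfolding L_def q_def by (rule quadratic_form_insert[of S s Q ?w]) (use insert.hyps herm in blast)+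
    finally have "0 \<le> Re (cnj (?w s) * Q s s * ?w s + cnj (?w s) * L ?w + cnj (L ?w) * ?w s + q ?w)" .
    moreover have "L ?w = L v"
      unfolding L_def by (intro sum.cong refl) (use insert.hyps in auto)
    moreover have "q ?w = q v"
      unfolding q_def by (intro sum.cong refl) (use insert.hyps in auto)
    ultimately show ?thesis by (simp only: d fun_upd_same)
  qed
  have d0: "d \<ge> 0"
    using pos[of 1 "\<lambda>_. 0"] by (simp add: L_def q_def)
  have row0: "Q s b = 0" if "d = 0" "b \<in> S" for b
  proof (rule ccontr)
    assume nz: "Q s b \<noteq> 0"
    let ?v = "\<lambda>y. if y = b then 1 else 0"
    define c where "c = (cmod (Q s b))\<^sup>2"
    have c: "c > 0" using nz by (simp add: c_def)
    have Lv: "L ?v = Q s b"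
      using that insert.hyps by (simp add: L_def if_distrib cong: if_cong)
    \<comment> \<open>With \<open>d = 0\<close> and \<open>t = - r * Q s b\<close> the form has real
      part \<open>- 2 * r * c + Re (q ?v)\<close>, which is unbounded below in \<open>r\<close>;
      this \<open>r\<close> makes it -1.\<close>
    define r where "r = (Re (q ?v) + 1) / (2 * c)"
    have "0 \<le> - 2 * r * c + Re (q ?v)"
      using pos[of "- (of_real r * Q s b)" ?v]
      unfolding Lv c_def cmod_power2 by (simp add: that algebra_simps power2_eq_square)
    moreover have "2 * r * c = Re (q ?v) + 1" using c by (simp add: r_def)
    ultimately show False by simp
  qed
  define Q' where "Q' a b = Q a b - Q a s * Q s b / of_real d" for a b
  have psd: "hermitian_psd_on S Q'"
    unfolding hermitian_psd_on_def
  proof (intro conjI ballI allI)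
    fix x y assume "x \<in> S" "y \<in> S"
    then show "Q' y x = cnj (Q' x y)"
      using herm[of x y] herm[of x s] herm[of y s] herm[of s y] by (simp add: Q'_def)
  next
    fix v
    have "(\<Sum>x\<in>S. \<Sum>y\<in>S. cnj (v x) * Q' x y * v y)
        = q v - (\<Sum>x\<in>S. \<Sum>y\<in>S. (cnj (v x) * Q x s) * (Q s y * v y) / of_real d)"
      unfolding q_def Q'_def by (simp add: sum_subtractf algebra_simps)
    also have "(\<Sum>x\<in>S. \<Sum>y\<in>S. (cnj (v x) * Q x s) * (Q s y * v y) / of_real d)
        = (\<Sum>x\<in>S. cnj (v x) * Q x s) * L v / of_real d"
      unfolding L_def by (simp add: sum_product sum_divide_distrib)
    also have "(\<Sum>x\<in>S. cnj (v x) * Q x s) = cnj (L v)"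
      using herm[of s] by (simp add: L_def mult.commute)
    finally have *: "(\<Sum>x\<in>S. \<Sum>y\<in>S. cnj (v x) * Q' x y * v y) = q v - cnj (L v) * L v / of_real d" .
    \<comment> \<open>For \<open>d > 0\<close> the choice \<open>t = - L v / d\<close> minimises the
      polynomial in \<open>t\<close>, and the minimum is the form of the Schur complement. For
      \<open>d = 0\<close> the same term is \<open>t = 0\<close>.\<close>
    show "0 \<le> Re (\<Sum>x\<in>S. \<Sum>y\<in>S. cnj (v x) * Q' x y * v y)"
      using pos[of "- (L v / of_real d)" v] unfolding *
      by (cases "d = 0") (simp_all add: field_simps)
  qed
  obtain n :: nat and v where v: "\<And>a b. a \<in> S \<Longrightarrow> b \<in> S \<Longrightarrow> Q' a b = (\<Sum>i<n. cnj (v i a) * v i b)"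
    using insert.IH[OF psd] by blast
  \<comment> \<open>The old vectors get coordinate 0 at \<open>s\<close>: the vector with index
    \<open>n\<close> alone produces the row and column of \<open>s\<close>. Two factors
    \<open>sqrt d\<close> make up the divisor \<open>d\<close> of the rank-one summand.\<close>
  define w where "w i a = (if i < n then if a = s then 0 else v i a else Q s a / of_real (sqrt d))" for i a
  have split: "(\<Sum>i<Suc n. cnj (w i a) * w i b)
      = (if a = s \<or> b = s then 0 else (\<Sum>i<n. cnj (v i a) * v i b)) + cnj (Q s a) * Q s b / of_real d" for a b
    using d0 by (simp add: w_def flip: of_real_mult)
  have "Q a b = (\<Sum>i<Suc n. cnj (w i a) * w i b)" if "a \<in> insert s S" "b \<in> insert s S" for a b
  proof -
    have "Q a b = Q a s * Q s b / of_real d" if "a = s \<or> b = s"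
      using that row0 herm[of s a] \<open>a \<in> _\<close> \<open>b \<in> _\<close> d by (cases "d = 0") auto
    then show ?thesis
      using that v[of a b] herm[of s a] unfolding split by (auto simp: Q'_def diff_eq_eq)
  qed
  then show ?case by blast
qed

section \<open>The dual group\<close>

lemma mem_carrier_dual_group:
  "\<chi> \<in> carrier (dual_group G) \<longleftrightarrow>
     \<chi> \<in> extensional (carrier G) \<and> (\<forall>g\<in>carrier G. \<chi> g \<noteq> 0) \<and>
     (\<forall>g\<in>carrier G. \<forall>h\<in>carrier G. \<chi> (g \<otimes>\<^bsub>G\<^esub> h) = \<chi> g * \<chi> h)"
  by (auto simp: dual_group_def complex_units_def hom_def)

lemma dual_group_mult_apply:
  "g \<in> carrier G \<Longrightarrow> (\<chi> \<otimes>\<^bsub>dual_group G\<^esub> \<psi>) g = \<chi> g * \<psi> g"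
  by (simp add: dual_group_def)

lemma dual_group_one_apply: "g \<in> carrier G \<Longrightarrow> \<one>\<^bsub>dual_group G\<^esub> g = 1"
  by (simp add: dual_group_def)

lemma dual_group_eqI:
  "\<chi> \<in> carrier (dual_group G) \<Longrightarrow> \<psi> \<in> carrier (dual_group G)
    \<Longrightarrow> (\<And>g. g \<in> carrier G \<Longrightarrow> \<chi> g = \<psi> g) \<Longrightarrow> \<chi> = \<psi>"
  by (auto simp: mem_carrier_dual_group intro: extensionalityI)

lemma comm_group_dual_group:
  assumes "group G"
  shows "comm_group (dual_group G)"
proof -
  interpret group G by fact
  show ?thesis
  proof (rule comm_groupI)
    fix \<chi> assume c: "\<chi> \<in> carrier (dual_group G)"
    let ?i = "\<lambda>g\<in>carrier G. inverse (\<chi> g)"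
    have "?i \<in> carrier (dual_group G)"
      using c by (auto simp: mem_carrier_dual_group)
    moreover have "?i \<otimes>\<^bsub>dual_group G\<^esub> \<chi> = \<one>\<^bsub>dual_group G\<^esub>"
      using c by (auto simp: dual_group_def complex_units_def hom_def Pi_def)
    ultimately show "\<exists>\<psi>\<in>carrier (dual_group G). \<psi> \<otimes>\<^bsub>dual_group G\<^esub> \<chi> = \<one>\<^bsub>dual_group G\<^esub>"
      by blast
  qed (auto simp: dual_group_def complex_units_def hom_def Pi_def extensional_def fun_eq_iff)
qed

section \<open>Extending characters from subgroups\<close>

context comm_group
begin

text \<open>The subgroup generated by \<open>H\<close> and \<open>x\<close> consists of the products
  \<open>h \<otimes> x [^] n\<close>, so an extension is fixed by its value \<open>z\<close> at
  \<open>x\<close>. The only obstruction is a power of \<open>x\<close> already in \<open>H\<close>,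
  where \<open>z\<close> must agree with \<open>\<chi>\<close>. Prescribing \<open>z\<close> also
  serves to separate points.\<close>

lemma extend_character_step:
  assumes H: "subgroup H G" and x: "x \<in> carrier G" and nz: "\<And>h. h \<in> H \<Longrightarrow> \<chi> h \<noteq> (0::complex)"
    and mult: "\<And>g h. g \<in> H \<Longrightarrow> h \<in> H \<Longrightarrow> \<chi> (g \<otimes> h) = \<chi> g * \<chi> h"
    and z: "z \<noteq> 0" "\<And>n::int. x [^] n \<in> H \<Longrightarrow> \<chi> (x [^] n) = z powi n"
  obtains H' \<psi> where "subgroup H' G" "H \<subseteq> H'" "x \<in> H'" "\<And>h. h \<in> H' \<Longrightarrow> \<psi> h \<noteq> (0::complex)"
    "\<And>g h. g \<in> H' \<Longrightarrow> h \<in> H' \<Longrightarrow> \<psi> (g \<otimes> h) = \<psi> g * \<psi> h" "\<And>h. h \<in> H \<Longrightarrow> \<psi> h = \<chi> h" "\<psi> x = z"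
proof -
  interpret H: subgroup H G by fact
  define H' where "H' = {h \<otimes> x [^] n |h (n::int). h \<in> H}"
  \<comment> \<open>Any representation of \<open>y\<close> may supply the value; \<open>wd\<close>
    shows that the choice does not matter.\<close>
  define \<psi> where "\<psi> y = (SOME c. \<exists>h (n::int). h \<in> H \<and> y = h \<otimes> x [^] n \<and> c = \<chi> h * z powi n)" for y
  have one: "\<chi> \<one> = 1"
    using mult[of \<one> \<one>] nz[of \<one>] by simp
  have wd: "\<chi> h * z powi n = \<chi> h' * z powi n'"
    if "h \<in> H" "h' \<in> H" "h \<otimes> x [^] n = h' \<otimes> x [^] n'" for h h' and n n' :: int
  proof -
    have [simp]: "h \<in> carrier G" "h' \<in> carrier G" using that by auto
    \<comment> \<open>Two representations of one element differ by a power of \<open>x\<close> that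
      lies in \<open>H\<close>, where the assumption on \<open>z\<close> applies.\<close>
    have "x [^] (n - n') = inv h \<otimes> (h \<otimes> x [^] n) \<otimes> inv (x [^] n')"
      using x by (simp add: int_pow_diff m_assoc[symmetric])
    also have "\<dots> = inv h \<otimes> h'"
      using x by (simp add: that(3) m_assoc)
    finally have eq: "x [^] (n - n') = inv h \<otimes> h'" .
    then have "z powi (n - n') = \<chi> (inv h \<otimes> h')"
      using z(2)[of "n - n'"] that by simp
    moreover have "\<chi> (h \<otimes> (inv h \<otimes> h')) = \<chi> h * \<chi> (inv h \<otimes> h')"
      using that by (intro mult) auto
    moreover have "h \<otimes> (inv h \<otimes> h') = h'" by (simp add: m_assoc[symmetric])
    ultimately have "\<chi> h' = \<chi> h * z powi (n - n')" by simp
    then show ?thesis using z(1) by (simp add: power_int_diff)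
  qed
  have val: "\<psi> (h \<otimes> x [^] n) = \<chi> h * z powi n" if "h \<in> H" for h and n :: int
    unfolding \<psi>_def
  proof (rule some_equality)
    show "\<exists>h' (n'::int). h' \<in> H \<and> h \<otimes> x [^] n = h' \<otimes> x [^] n' \<and> \<chi> h * z powi n = \<chi> h' * z powi n'"
      using that by blast
    show "c = \<chi> h * z powi n"
      if "\<exists>h' (n'::int). h' \<in> H \<and> h \<otimes> x [^] n = h' \<otimes> x [^] n' \<and> c = \<chi> h' * z powi n'" for c
      using that wd[OF \<open>h \<in> H\<close>] by metis
  qed
  have prod: "(h \<otimes> x [^] n) \<otimes> (h' \<otimes> x [^] n') = (h \<otimes> h') \<otimes> x [^] (n + n')"
    if "h \<in> H" "h' \<in> H" for h h' and n n' :: int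
    using that x by (simp add: int_pow_mult m_ac H.mem_carrier)
  show ?thesis
  proof
    show "subgroup H' G"
    proof (rule subgroupI)
      show "H' \<subseteq> carrier G" using x by (auto simp: H'_def)
      show "H' \<noteq> {}" by (auto simp: H'_def intro: H.one_closed)
    next
      fix a assume "a \<in> H'"
      then obtain h and n :: int where "h \<in> H" "a = h \<otimes> x [^] n" by (auto simp: H'_def)
      then have "inv a = inv h \<otimes> x [^] (- n)" "inv h \<in> H"
        using x by (simp_all add: inv_mult int_pow_neg)
      then show "inv a \<in> H'" unfolding H'_def by blast
    next
      fix a b assume "a \<in> H'" "b \<in> H'"
      then obtain h h' and n n' :: int
        where "h \<in> H" "h' \<in> H" "a = h \<otimes> x [^] n" "b = h' \<otimes> x [^] n'" by (auto simp: H'_def)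
      then show "a \<otimes> b \<in> H'" using prod unfolding H'_def by blast
    qed
    show "H \<subseteq> H'"
    proof
      fix h assume "h \<in> H"
      moreover from this have "h = h \<otimes> x [^] (0::int)" by simp
      ultimately show "h \<in> H'" unfolding H'_def by blast
    qed
    have x': "x = \<one> \<otimes> x [^] (1::int)" using x by simp
    then show "x \<in> H'" unfolding H'_def using H.one_closed by blast
    show "\<psi> x = z" using val[OF H.one_closed, of 1] x one by simp
    show "\<psi> h = \<chi> h" if "h \<in> H" for h using val[OF that, of 0] that by simp
    show "\<psi> h \<noteq> 0" if "h \<in> H'" for h
      using that z(1) nz by (auto simp: H'_def val)
    show "\<psi> (a \<otimes> b) = \<psi> a * \<psi> b" if ab: "a \<in> H'" "b \<in> H'" for a b
    proof -
      obtain h h' and n n' :: int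
        where "h \<in> H" "h' \<in> H" "a = h \<otimes> x [^] n" "b = h' \<otimes> x [^] n'" using ab by (auto simp: H'_def)
      then show ?thesis using z(1) by (simp add: prod val mult power_int_add)
    qed
  qed
qed

lemma character_on_int_pow:
  assumes H: "subgroup H G" and y: "y \<in> H" and nz: "\<And>h. h \<in> H \<Longrightarrow> \<chi> h \<noteq> (0::complex)"
    and mult: "\<And>g h. g \<in> H \<Longrightarrow> h \<in> H \<Longrightarrow> \<chi> (g \<otimes> h) = \<chi> g * \<chi> h"
  shows "\<chi> (y [^] (n::int)) = \<chi> y powi n"
proof -
  interpret H: subgroup H G by fact
  have one: "\<chi> \<one> = 1"
    using mult[of \<one> \<one>] nz[of \<one>] by simp
  have pow_mem: "y [^] k \<in> H" for k :: nat
    using y by (induction k) auto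
  have pow: "\<chi> (y [^] k) = \<chi> y ^ k" for k :: nat
    by (induction k) (simp_all add: one mult pow_mem y)
  have inv: "\<chi> (inv a) = inverse (\<chi> a)" if "a \<in> H" for a
    using mult[of "inv a" a] that one nz[OF that] by (simp add: H.mem_carrier field_simps)
  show ?thesis
  proof (cases n rule: int_cases2)
    case (nonneg k)
    then show ?thesis by (simp add: int_pow_int pow)
  next
    case (nonpos k)
    then show ?thesis
      using H.mem_carrier[OF y] by (simp add: int_pow_neg_int inv pow pow_mem power_int_minus)
  qed
qed

text \<open>Nonzero complex numbers have roots of every positive order, so a character extends past
  any \<open>x\<close> outside \<open>H\<close>. Each step enlarges \<open>H\<close>, whence
  induction on the number of elements outside it.\<close>

lemma exists_character_extension:
  assumes fin: "finite (carrier G)" and H: "subgroup H G" and nz: "\<And>h. h \<in> H \<Longrightarrow> \<chi> h \<noteq> 0"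
    and mult: "\<And>g h. g \<in> H \<Longrightarrow> h \<in> H \<Longrightarrow> \<chi> (g \<otimes> h) = \<chi> g * \<chi> h"
  shows "\<exists>\<psi>\<in>carrier (dual_group G). \<forall>h\<in>H. \<psi> h = \<chi> h"
  using H nz mult
proof (induction "card (carrier G - H)" arbitrary: H \<chi> rule: less_induct)
  case less
  interpret H: subgroup H G by (rule less.prems(1))
  show ?case
  proof (cases "H = carrier G")
    case True
    then show ?thesis
      using less.prems by (intro bexI[of _ "restrict \<chi> (carrier G)"]) (auto simp: mem_carrier_dual_group)
  next
    case False
    then obtain x where x: "x \<in> carrier G" "x \<notin> H" using H.subset by blast
    \<comment> \<open>\<open>k\<close> is the order of \<open>x\<close> modulo \<open>H\<close>. The
      powers of \<open>x\<close> in \<open>H\<close> are the powers of \<open>x [^] k\<close>, so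
      \<open>z\<close> only has to be a \<open>k\<close>-th root of
      \<open>\<chi> (x [^] k)\<close>.\<close>
    define k where "k = (LEAST k::nat. 0 < k \<and> x [^] k \<in> H)"
    have "0 < order G \<and> x [^] order G \<in> H"
      using fin x pow_order_eq_1[OF x(1)] order_gt_0_iff_finite by simp
    then have k: "0 < k \<and> x [^] k \<in> H"
      unfolding k_def by (rule LeastI)
    then have "card {z. z ^ k = \<chi> (x [^] k)} = k"
      using less.prems(2) by (intro card_nth_roots) auto
    then obtain z where z: "z ^ k = \<chi> (x [^] k)"
      using k by (metis (mono_tags) card.empty empty_Collect_eq less_irrefl)
    have z0: "z \<noteq> 0"
    proof
      assume "z = 0"
      then show False using z k less.prems(2)[of "x [^] k"] by (simp add: zero_power)
    qed
    have zn: "\<chi> (x [^] n) = z powi n" if n: "x [^] n \<in> H" for n :: int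
    proof -
      \<comment> \<open>Reducing the exponent modulo \<open>k\<close> keeps the power in
        \<open>H\<close>, so minimality of \<open>k\<close> forces the remainder to be 0.\<close>
      define m where "m = nat (n mod int k)"
      have m: "int m = n mod int k" "m < k"
        using k by (auto simp: m_def nat_less_iff)
      have xk: "x [^] (int k * q) = (x [^] k) [^] q" for q :: int
        using int_pow_pow[OF x(1)] by (metis int_pow_int)
      have "x [^] (n mod int k) = x [^] n \<otimes> inv ((x [^] k) [^] (n div int k))"
        using x(1) by (simp add: minus_div_mult_eq_mod[symmetric] int_pow_diff xk[symmetric] mult.commute)
      also have "\<dots> \<in> H"
        using n k subgroup_int_pow_closed[OF less.prems(1)] by simp
      finally have "x [^] m \<in> H"
        using m by (metis int_pow_int)
      then have "m = 0"
        using m(2) not_less_Least[of m "\<lambda>k. 0 < k \<and> x [^] k \<in> H"] unfolding k_def by auto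
      then have dvd: "n = int k * (n div int k)"
        using m by auto
      then have "\<chi> (x [^] n) = \<chi> ((x [^] k) [^] (n div int k))"
        by (metis xk)
      also have "\<dots> = (z ^ k) powi (n div int k)"
        using character_on_int_pow[OF less.prems(1) _ less.prems(2,3)] k z by simp
      also have "\<dots> = z powi n"
        by (subst (2) dvd) (simp add: power_int_mult)
      finally show ?thesis .
    qed
    show ?thesis
    proof (rule extend_character_step[OF less.prems(1) x(1) less.prems(2,3) z0 zn])
      fix H' \<psi>
      assume H': "subgroup H' G" "H \<subseteq> H'" "x \<in> H'" and \<psi>: "\<And>h. h \<in> H \<Longrightarrow> \<psi> h = \<chi> h"
        and nz: "\<And>h. h \<in> H' \<Longrightarrow> \<psi> h \<noteq> (0::complex)"
        and mult: "\<And>g h. g \<in> H' \<Longrightarrow> h \<in> H' \<Longrightarrow> \<psi> (g \<otimes> h) = \<psi> g * \<psi> h"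
      have "card (carrier G - H') < card (carrier G - H)"
        using fin x H'(2,3) by (intro psubset_card_mono) auto
      then obtain \<phi> where "\<phi> \<in> carrier (dual_group G)" "\<forall>h\<in>H'. \<phi> h = \<psi> h"
        using less.hyps[of H' \<psi>] H'(1) nz mult by blast
      then show ?thesis
        using H'(2) \<psi> by (intro bexI[of _ \<phi>]) auto
    qed
  qed
qed

text \<open>A character of the cyclic group generated by \<open>g\<close> may send \<open>g\<close>
  to any root of unity of order dividing \<open>ord g\<close>; one other than 1 exists, and
  extension to \<open>G\<close> keeps this value.\<close>

lemma characters_separate_points:
  assumes fin: "finite (carrier G)" and g: "g \<in> carrier G" "g \<noteq> \<one>"
  shows "\<exists>\<chi>\<in>carrier (dual_group G). \<chi> g \<noteq> 1"
proof -
  have ord: "ord g > 1"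
    using ord_ge_1[OF fin g(1)] ord_eq_1[OF g(1)] g(2) by linarith
  then have "{z::complex. z ^ ord g = 1} \<noteq> {1}"
    using card_roots_unity_eq[of "ord g"] by auto
  moreover have "1 \<in> {z::complex. z ^ ord g = 1}" by simp
  ultimately obtain z :: complex where z: "z ^ ord g = 1" "z \<noteq> 1"
    by blast
  have z0: "z \<noteq> 0" using z ord by (auto simp: zero_power)
  \<comment> \<open>The compatibility condition for adjoining \<open>g\<close> to the trivial
    subgroup.\<close>
  have zn: "z powi n = 1" if n: "g [^] n \<in> {\<one>}" for n :: int
  proof -
    obtain q where "n = int (ord g) * q"
      using n int_pow_eq_id[OF g(1), of n] by (auto elim: dvdE)
    then show ?thesis using z(1) by (simp add: power_int_mult)
  qed
  show ?thesis
  proof (rule extend_character_step[OF triv_subgroup g(1), where \<chi> = "\<lambda>_. 1" and z = z])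
    fix H \<psi>
    assume H: "subgroup H G" "g \<in> H" "\<psi> g = z" and nz: "\<And>h. h \<in> H \<Longrightarrow> \<psi> h \<noteq> (0::complex)"
      and mult: "\<And>g h. g \<in> H \<Longrightarrow> h \<in> H \<Longrightarrow> \<psi> (g \<otimes> h) = \<psi> g * \<psi> h"
    obtain \<chi> where "\<chi> \<in> carrier (dual_group G)" "\<forall>h\<in>H. \<chi> h = \<psi> h"
      using exists_character_extension[OF fin H(1) nz mult] by blast
    then show ?thesis using H(2,3) z(2) by (intro bexI[of _ \<chi>]) auto
  next
    show "1 = z powi n" if "g [^] n \<in> {\<one>}" for n :: int
      using zn[OF that] by simp
  qed (use z0 in simp_all)
qed

end

section \<open>Orthogonality of characters\<close>

context group
begin

text \<open>Left translation permutes the group. Applied to \<open>G\<close> and to its dual, this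
  makes character sums vanish.\<close>

lemma sum_translate:
  assumes "a \<in> carrier G"
  shows "(\<Sum>x\<in>carrier G. F (a \<otimes> x)) = (\<Sum>x\<in>carrier G. F x)"
  by (rule sum.reindex_bij_witness[where i = "\<lambda>x. inv a \<otimes> x" and j = "\<lambda>x. a \<otimes> x"])
     (use assms in \<open>auto simp: m_assoc[symmetric]\<close>)

lemma character_one:
  assumes "\<chi> \<in> carrier (dual_group G)"
  shows "\<chi> \<one> = 1"
  using assms unfolding mem_carrier_dual_group by (metis mult_cancel_left2 one_closed r_one)

lemma character_pow_order:
  assumes "finite (carrier G)" "\<chi> \<in> carrier (dual_group G)" "g \<in> carrier G"
  shows "\<chi> g ^ order G = 1"
proof -
  have "\<chi> (g [^] n) = \<chi> g ^ n" for n :: nat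
    using assms(2,3) by (induction n) (simp_all add: character_one mem_carrier_dual_group)
  then show ?thesis
    using character_one[OF assms(2)] pow_order_eq_1[OF assms(3)] by metis
qed

text \<open>Character values are roots of unity, hence of modulus 1, where the reciprocal is the
  conjugate.\<close>

lemma character_inv:
  assumes fin: "finite (carrier G)" and \<chi>: "\<chi> \<in> carrier (dual_group G)" and g: "g \<in> carrier G"
  shows "cnj (\<chi> g) * \<chi> g = 1" "\<chi> (inv g) = cnj (\<chi> g)" "(inv\<^bsub>dual_group G\<^esub> \<chi>) g = cnj (\<chi> g)"
proof -
  interpret D: comm_group "dual_group G" by (rule comm_group_dual_group) (rule is_group)
  have "\<chi> g ^ order G = 1 ^ order G"
    using character_pow_order[OF assms] by simp
  then have "cmod (\<chi> g) = 1"
    using fin order_gt_0_iff_finite by (metis power_eq_imp_eq_norm norm_one)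
  then show unit: "cnj (\<chi> g) * \<chi> g = 1"
    by (metis complex_norm_square mult.commute of_real_1 one_power2)
  then have nz: "\<chi> g \<noteq> 0" by auto
  have "\<chi> (inv g) * \<chi> g = \<chi> (inv g \<otimes> g)"
    using \<chi> g inv_closed unfolding mem_carrier_dual_group by metis
  then have "\<chi> (inv g) * \<chi> g = 1" using g character_one[OF \<chi>] by simp
  with unit nz show "\<chi> (inv g) = cnj (\<chi> g)"
    by (metis mult_right_cancel)
  have "(inv\<^bsub>dual_group G\<^esub> \<chi>) g * \<chi> g = 1"
    using D.l_inv[OF \<chi>] dual_group_one_apply[OF g] dual_group_mult_apply[OF g] by metis
  with unit nz show "(inv\<^bsub>dual_group G\<^esub> \<chi>) g = cnj (\<chi> g)"
    by (metis mult_right_cancel)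
qed

lemma finite_dual_group:
  assumes "finite (carrier G)"
  shows "finite (carrier (dual_group G))"
proof (rule finite_subset)
  show "carrier (dual_group G) \<subseteq> (\<Pi>\<^sub>E g\<in>carrier G. {z. z ^ order G = 1})"
    using character_pow_order[OF assms] by (auto simp: mem_carrier_dual_group PiE_def)
  show "finite (\<Pi>\<^sub>E g\<in>carrier G. {z::complex. z ^ order G = 1})"
    using assms order_gt_0_iff_finite by (intro finite_PiE finite_nth_roots) auto
qed

text \<open>Translation by some \<open>h\<close> with \<open>\<chi> h \<noteq> 1\<close> multiplies
  the sum by \<open>\<chi> h\<close> without changing it.\<close>

lemma sum_character_eq_0:
  assumes \<chi>: "\<chi> \<in> carrier (dual_group G)" "\<chi> \<noteq> \<one>\<^bsub>dual_group G\<^esub>"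
  shows "(\<Sum>g\<in>carrier G. \<chi> g) = 0"
proof -
  interpret D: comm_group "dual_group G" by (rule comm_group_dual_group) (rule is_group)
  obtain h where h: "h \<in> carrier G" "\<chi> h \<noteq> 1"
    using dual_group_eqI[OF \<chi>(1) D.one_closed] \<chi>(2) dual_group_one_apply by metis
  have "(\<Sum>g\<in>carrier G. \<chi> g) = (\<Sum>g\<in>carrier G. \<chi> (h \<otimes> g))"
    by (rule sum_translate[OF h(1), symmetric])
  also have "\<dots> = \<chi> h * (\<Sum>g\<in>carrier G. \<chi> g)"
    using \<chi> h by (simp add: mem_carrier_dual_group sum_distrib_left)
  finally show ?thesis using h(2) by simp
qed

text \<open>The summands are the values of the quotient of \<open>\<chi>\<close> by
  \<open>\<psi>\<close>, a character that is trivial only for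
  \<open>\<chi> = \<psi>\<close>.\<close>

lemma character_orthogonality:
  assumes fin: "finite (carrier G)" and c: "\<chi> \<in> carrier (dual_group G)" "\<psi> \<in> carrier (dual_group G)"
  shows "(\<Sum>g\<in>carrier G. \<chi> g * cnj (\<psi> g)) = (if \<chi> = \<psi> then of_nat (order G) else 0)"
proof -
  interpret D: comm_group "dual_group G" by (rule comm_group_dual_group) (rule is_group)
  let ?\<phi> = "\<chi> \<otimes>\<^bsub>dual_group G\<^esub> inv\<^bsub>dual_group G\<^esub> \<psi>"
  have "(\<Sum>g\<in>carrier G. \<chi> g * cnj (\<psi> g)) = (\<Sum>g\<in>carrier G. ?\<phi> g)"
    by (intro sum.cong refl) (simp add: dual_group_mult_apply character_inv[OF fin c(2)])
  also have "\<dots> = (if \<chi> = \<psi> then of_nat (order G) else 0)"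
  proof (cases "\<chi> = \<psi>")
    case True
    then show ?thesis
      using c by (simp add: dual_group_one_apply order_def)
  next
    case False
    then have "?\<phi> \<noteq> \<one>\<^bsub>dual_group G\<^esub>"
      using c by (metis D.inv_closed D.inv_equality D.inv_inv)
    then show ?thesis using c False by (simp add: sum_character_eq_0)
  qed
  finally show ?thesis .
qed

end

section \<open>Orthogonality over the dual group and Fourier inversion\<close>

context comm_group
begin

text \<open>The translation argument in the dual group: a character separating \<open>g\<close> from
  \<open>\<one>\<close> supplies the factor other than 1.\<close>

lemma sum_over_characters_eq_0:
  assumes fin: "finite (carrier G)" and g: "g \<in> carrier G" "g \<noteq> \<one>"
  shows "(\<Sum>\<chi>\<in>carrier (dual_group G). \<chi> g) = 0"
proof -
  interpret D: comm_group "dual_group G" by (rule comm_group_dual_group) (rule is_group)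
  obtain \<psi> where \<psi>: "\<psi> \<in> carrier (dual_group G)" "\<psi> g \<noteq> 1"
    using characters_separate_points[OF assms] by blast
  have "(\<Sum>\<chi>\<in>carrier (dual_group G). \<chi> g) = (\<Sum>\<chi>\<in>carrier (dual_group G). (\<psi> \<otimes>\<^bsub>dual_group G\<^esub> \<chi>) g)"
    by (rule D.sum_translate[OF \<psi>(1), symmetric])
  also have "\<dots> = \<psi> g * (\<Sum>\<chi>\<in>carrier (dual_group G). \<chi> g)"
    using g by (simp add: dual_group_mult_apply sum_distrib_left)
  finally show ?thesis using \<psi>(2) by simp
qed

text \<open>Both sides count the double sum of all \<open>\<chi> g\<close>: only \<open>g = \<one>\<close> contributes when summing over \<open>\<chi>\<close>
  first, and only the trivial character when summing over \<open>g\<close> first.\<close>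

lemma card_dual_group:
  assumes fin: "finite (carrier G)"
  shows "card (carrier (dual_group G)) = order G"
proof -
  interpret D: comm_group "dual_group G" by (rule comm_group_dual_group) (rule is_group)
  have "(\<Sum>g\<in>carrier G. \<Sum>\<chi>\<in>carrier (dual_group G). \<chi> g)
      = (\<Sum>g\<in>carrier G. if g = \<one> then of_nat (card (carrier (dual_group G))) else 0)"
    by (intro sum.cong refl) (auto simp: sum_over_characters_eq_0[OF fin] character_one)
  also have "\<dots> = of_nat (card (carrier (dual_group G)))"
    using fin by simp
  finally have 1: "(\<Sum>g\<in>carrier G. \<Sum>\<chi>\<in>carrier (dual_group G). \<chi> g) = of_nat (card (carrier (dual_group G)))" .
  have "(\<Sum>\<chi>\<in>carrier (dual_group G). \<Sum>g\<in>carrier G. \<chi> g)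
      = (\<Sum>\<chi>\<in>carrier (dual_group G). if \<chi> = \<one>\<^bsub>dual_group G\<^esub> then of_nat (order G) else 0)"
    by (intro sum.cong refl) (auto simp: sum_character_eq_0 dual_group_one_apply order_def)
  also have "\<dots> = of_nat (order G)"
    using finite_dual_group[OF fin] by simp
  finally have "of_nat (card (carrier (dual_group G))) = (of_nat (order G) :: complex)"
    using 1 by (subst (asm) sum.swap) simp
  then show ?thesis by (simp only: of_nat_eq_iff)
qed

lemma dual_character_orthogonality:
  assumes fin: "finite (carrier G)" and g: "g \<in> carrier G" "h \<in> carrier G"
  shows "(\<Sum>\<chi>\<in>carrier (dual_group G). \<chi> g * cnj (\<chi> h)) = (if g = h then of_nat (order G) else 0)"
proof (cases "g = h")
  case True
  then show ?thesis
    using character_inv(1)[OF fin _ g(2)] card_dual_group[OF fin] by (simp add: mult.commute)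
next
  case False
  then have ne: "g \<otimes> inv h \<noteq> \<one>"
    using g by (metis inv_closed inv_equality inv_inv)
  have "\<chi> g * cnj (\<chi> h) = \<chi> (g \<otimes> inv h)" if "\<chi> \<in> carrier (dual_group G)" for \<chi>
    using that g character_inv(2)[OF fin that g(2)] by (simp add: mem_carrier_dual_group)
  then have "(\<Sum>\<chi>\<in>carrier (dual_group G). \<chi> g * cnj (\<chi> h)) = (\<Sum>\<chi>\<in>carrier (dual_group G). \<chi> (g \<otimes> inv h))"
    by (intro sum.cong refl)
  then show ?thesis
    using False ne g by (simp add: sum_over_characters_eq_0[OF fin])
qed

text \<open>Exchanging the sums leaves, for each \<open>x\<close>, an orthogonality sum over the
  dual that vanishes unless \<open>x = g\<close>.\<close>

lemma fourier_inversion: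
  assumes fin: "finite (carrier G)" and g: "g \<in> carrier G"
  shows "(\<Sum>\<chi>\<in>carrier (dual_group G). fourier_coeff G h \<chi> * \<chi> g) = h g"
proof -
  have "(\<Sum>\<chi>\<in>carrier (dual_group G). fourier_coeff G h \<chi> * \<chi> g)
      = (\<Sum>\<chi>\<in>carrier (dual_group G). \<Sum>x\<in>carrier G. h x / of_nat (order G) * (\<chi> g * cnj (\<chi> x)))"
    by (simp add: fourier_coeff_def sum_distrib_left sum_distrib_right mult_ac)
  also have "\<dots> = (\<Sum>x\<in>carrier G. h x / of_nat (order G) * (\<Sum>\<chi>\<in>carrier (dual_group G). \<chi> g * cnj (\<chi> x)))"
    by (subst sum.swap) (simp add: sum_distrib_left)
  also have "\<dots> = (\<Sum>x\<in>carrier G. if g = x then h x else 0)"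
    using fin g order_gt_0_iff_finite
    by (intro sum.cong refl) (simp add: dual_character_orthogonality)
  also have "\<dots> = h g" using fin g by simp
  finally show ?thesis .
qed

text \<open>Pairing the expansion with \<open>\<psi>\<close> isolates one coefficient by
  orthogonality.\<close>

lemma fourier_coeff_unique:
  assumes fin: "finite (carrier G)" and \<psi>: "\<psi> \<in> carrier (dual_group G)"
    and h: "\<And>g. g \<in> carrier G \<Longrightarrow> h g = (\<Sum>\<chi>\<in>carrier (dual_group G). a \<chi> * \<chi> g)"
  shows "fourier_coeff G h \<psi> = a \<psi>"
proof -
  have "(\<Sum>g\<in>carrier G. h g * cnj (\<psi> g))
      = (\<Sum>g\<in>carrier G. \<Sum>\<chi>\<in>carrier (dual_group G). a \<chi> * (\<chi> g * cnj (\<psi> g)))"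
    by (simp add: h sum_distrib_right mult.assoc)
  also have "\<dots> = (\<Sum>\<chi>\<in>carrier (dual_group G). a \<chi> * (\<Sum>g\<in>carrier G. \<chi> g * cnj (\<psi> g)))"
    by (subst sum.swap) (simp add: sum_distrib_left)
  also have "\<dots> = (\<Sum>\<chi>\<in>carrier (dual_group G). if \<chi> = \<psi> then a \<psi> * of_nat (order G) else 0)"
    by (intro sum.cong refl) (simp add: character_orthogonality[OF fin _ \<psi>])
  also have "\<dots> = a \<psi> * of_nat (order G)"
    using finite_dual_group[OF fin] \<psi> by simp
  finally show ?thesis
    using fin order_gt_0_iff_finite by (simp add: fourier_coeff_def)
qed

section \<open>The semidefinite program in Fourier coordinates\<close>

text \<open>The constraint sums of the semidefinite program are the Fourier coefficients of the quadratic
  form \<open>Q\<close> evaluated at the vector of characters.\<close>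

lemma quadratic_form_in_characters:
  assumes fin: "finite (carrier G)" and S: "S \<subseteq> carrier (dual_group G)" and Q: "Q \<in> matrices_on S"
    and g: "g \<in> carrier G"
  shows "(\<Sum>a\<in>S. \<Sum>b\<in>S. Q a b * (cnj (a g) * b g)) =
    (\<Sum>\<chi>\<in>carrier (dual_group G).
       (\<Sum>\<chi>'\<in>carrier (dual_group G). Q (inv\<^bsub>dual_group G\<^esub> \<chi> \<otimes>\<^bsub>dual_group G\<^esub> \<chi>') \<chi>') * \<chi> g)"
    (is "?lhs = ?rhs")
proof -
  interpret D: comm_group "dual_group G" by (rule comm_group_dual_group) (rule is_group)
  let ?D = "carrier (dual_group G)"
  note finD = finite_dual_group[OF fin]
  have zero: "Q a b = 0" if "a \<notin> S \<or> b \<notin> S" for a b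
    using Q that unfolding matrices_on_def by blast
  \<comment> \<open>Zero entries outside \<open>S\<close> let both indices range over the whole dual
    group, on which the substitution below acts.\<close>
  have "?lhs = (\<Sum>a\<in>S. \<Sum>b\<in>?D. Q a b * (cnj (a g) * b g))"
    by (intro sum.cong refl sum.mono_neutral_left) (use finD S zero in auto)
  also have "\<dots> = (\<Sum>a\<in>?D. \<Sum>b\<in>?D. Q a b * (cnj (a g) * b g))"
    by (rule sum.mono_neutral_left) (use finD S zero in auto)
  also have "\<dots> = (\<Sum>b\<in>?D. \<Sum>a\<in>?D. Q a b * (cnj (a g) * b g))"
    by (rule sum.swap)
  also have "\<dots> = (\<Sum>b\<in>?D. \<Sum>\<chi>\<in>?D. Q (inv\<^bsub>dual_group G\<^esub> \<chi> \<otimes>\<^bsub>dual_group G\<^esub> b) b * \<chi> g)"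
  proof (rule sum.cong[OF refl])
    fix b assume b: "b \<in> ?D"
    \<comment> \<open>For fixed \<open>b\<close> this involution exchanges \<open>a\<close> and
      \<open>\<chi>\<close>; if \<open>a = ?i \<chi>\<close>, then \<open>cnj (a g) * b g\<close>
      equals \<open>\<chi> g\<close>.\<close>
    let ?i = "\<lambda>\<chi>. inv\<^bsub>dual_group G\<^esub> \<chi> \<otimes>\<^bsub>dual_group G\<^esub> b"
    have invol: "?i (?i \<chi>) = \<chi>" if "\<chi> \<in> ?D" for \<chi>
      using that b by (simp add: D.inv_mult D.m_assoc)
    have cl: "?i \<chi> \<in> ?D" if "\<chi> \<in> ?D" for \<chi>
      using that b by simp
    show "(\<Sum>a\<in>?D. Q a b * (cnj (a g) * b g)) = (\<Sum>\<chi>\<in>?D. Q (?i \<chi>) b * \<chi> g)"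
    proof (rule sum.reindex_bij_witness[where i = ?i and j = ?i])
      fix a assume a: "a \<in> ?D"
      have "?i a g = cnj (a g) * b g"
        using a character_inv(3)[OF fin a g] g by (simp add: dual_group_mult_apply)
      then show "Q (?i (?i a)) b * ?i a g = Q a b * (cnj (a g) * b g)"
        using invol[OF a] by simp
    qed (use invol cl in auto)
  qed
  also have "\<dots> = ?rhs"
    by (subst sum.swap) (simp add: sum_distrib_right)
  finally show ?thesis .
qed

text \<open>Constraints and objective together prescribe every Fourier coefficient of
  \<open>f\<close>; inversion and uniqueness turn this into a pointwise identity on
  \<open>G\<close>.\<close>

lemma sdp_solution_iff:
  assumes fin: "finite (carrier G)" and S: "S \<subseteq> carrier (dual_group G)"
    and Q: "Q \<in> matrices_on S" "hermitian_psd_on S Q"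
  shows "Q \<in> sdp_feasible G f S \<and> sdp_objective G f S Q = complex_of_real \<alpha> \<longleftrightarrow>
    (\<forall>g\<in>carrier G. complex_of_real (f g - \<alpha>) = (\<Sum>a\<in>S. \<Sum>b\<in>S. Q a b * (cnj (a g) * b g)))"
    (is "_ \<longleftrightarrow> ?cert")
proof -
  interpret D: comm_group "dual_group G" by (rule comm_group_dual_group) (rule is_group)
  let ?D = "carrier (dual_group G)" and ?one = "\<one>\<^bsub>dual_group G\<^esub>"
  let ?c = "fourier_coeff G (\<lambda>g. complex_of_real (f g))"
  note finD = finite_dual_group[OF fin]
  define K where "K \<chi> = (\<Sum>\<chi>'\<in>?D. Q (inv\<^bsub>dual_group G\<^esub> \<chi> \<otimes>\<^bsub>dual_group G\<^esub> \<chi>') \<chi>')" for \<chi>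
  have "K ?one = (\<Sum>\<chi>\<in>?D. Q \<chi> \<chi>)"
    by (simp add: K_def)
  also have "\<dots> = trace_on S Q"
    unfolding trace_on_def
    by (rule sum.mono_neutral_right) (use finD S Q(1) in \<open>auto simp: matrices_on_def\<close>)
  finally have K1: "K ?one = trace_on S Q" .
  \<comment> \<open>The constant \<open>\<alpha>\<close> is \<open>\<alpha>\<close> times the
    trivial character, so \<open>a\<close> lists the coefficients that \<open>f\<close> must
    have.\<close>
  define a where "a \<chi> = K \<chi> + (if \<chi> = ?one then complex_of_real \<alpha> else 0)" for \<chi>
  have "Q \<in> sdp_feasible G f S \<and> sdp_objective G f S Q = complex_of_real \<alpha> \<longleftrightarrow> (\<forall>\<chi>\<in>?D. ?c \<chi> = a \<chi>)"
  proof
    assume "Q \<in> sdp_feasible G f S \<and> sdp_objective G f S Q = complex_of_real \<alpha>"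
    then show "\<forall>\<chi>\<in>?D. ?c \<chi> = a \<chi>"
      by (auto simp: sdp_feasible_def sdp_objective_def a_def K1 diff_eq_eq simp flip: K_def)
  next
    assume c: "\<forall>\<chi>\<in>?D. ?c \<chi> = a \<chi>"
    have "?c ?one = trace_on S Q + complex_of_real \<alpha>"
      using c by (simp add: a_def K1)
    then show "Q \<in> sdp_feasible G f S \<and> sdp_objective G f S Q = complex_of_real \<alpha>"
      using c Q by (auto simp: sdp_feasible_def sdp_objective_def a_def simp flip: K_def)
  qed
  also have "\<dots> \<longleftrightarrow> (\<forall>g\<in>carrier G. complex_of_real (f g) = (\<Sum>\<chi>\<in>?D. a \<chi> * \<chi> g))"
  proof
    assume c: "\<forall>\<chi>\<in>?D. ?c \<chi> = a \<chi>"
    show "\<forall>g\<in>carrier G. complex_of_real (f g) = (\<Sum>\<chi>\<in>?D. a \<chi> * \<chi> g)"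
    proof
      fix g assume g: "g \<in> carrier G"
      have "(\<Sum>\<chi>\<in>?D. a \<chi> * \<chi> g) = (\<Sum>\<chi>\<in>?D. ?c \<chi> * \<chi> g)"
        using c by (intro sum.cong refl) simp
      then show "complex_of_real (f g) = (\<Sum>\<chi>\<in>?D. a \<chi> * \<chi> g)"
        using fourier_inversion[OF fin g, of "\<lambda>g. complex_of_real (f g)"] by simp
    qed
  next
    assume "\<forall>g\<in>carrier G. complex_of_real (f g) = (\<Sum>\<chi>\<in>?D. a \<chi> * \<chi> g)"
    then show "\<forall>\<chi>\<in>?D. ?c \<chi> = a \<chi>"
      by (intro ballI fourier_coeff_unique[OF fin]) simp_all
  qed
  also have "\<dots> \<longleftrightarrow> ?cert"
  proof (rule ball_cong[OF refl])
    fix g assume g: "g \<in> carrier G"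
    have "(\<Sum>\<chi>\<in>?D. a \<chi> * \<chi> g)
        = (\<Sum>\<chi>\<in>?D. K \<chi> * \<chi> g) + (\<Sum>\<chi>\<in>?D. if \<chi> = ?one then complex_of_real \<alpha> * \<chi> g else 0)"
      unfolding sum.distrib[symmetric] by (intro sum.cong refl) (simp add: a_def distrib_right)
    also have "\<dots> = (\<Sum>a\<in>S. \<Sum>b\<in>S. Q a b * (cnj (a g) * b g)) + complex_of_real \<alpha>"
      using finD g by (simp add: quadratic_form_in_characters[OF fin S Q(1) g] K_def dual_group_one_apply)
    finally show "complex_of_real (f g) = (\<Sum>\<chi>\<in>?D. a \<chi> * \<chi> g) \<longleftrightarrow>
        complex_of_real (f g - \<alpha>) = (\<Sum>a\<in>S. \<Sum>b\<in>S. Q a b * (cnj (a g) * b g))"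
      by (simp add: diff_eq_eq)
  qed
  finally show ?thesis .
qed

end

section \<open>From sums of squares to matrices and back\<close>

theorem lemma3p2:
  fixes G :: "('a, 'b) monoid_scheme"
    and f :: "'a \<Rightarrow> real"
    and S :: "('a \<Rightarrow> complex) set"
  assumes "comm_group G" and "finite (carrier G)"
    and "S \<subseteq> carrier (dual_group G)"
  shows "\<forall>\<alpha>::real.
    (\<exists>(I, h)\<in>sos_families G f S. sos_certificate G f \<alpha> I h) \<longleftrightarrow>
    (\<exists>Q\<in>sdp_feasible G f S. sdp_objective G f S Q = complex_of_real \<alpha>)"
proof (intro allI iffI)
  interpret comm_group G by fact
  note fin = assms(2) and S = assms(3)
  let ?D = "carrier (dual_group G)"
  have finD: "finite ?D" by (rule finite_dual_group[OF fin])
  fix \<alpha> :: real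
  {
    assume "\<exists>(I, h)\<in>sos_families G f S. sos_certificate G f \<alpha> I h"
    then obtain I h where Ih: "(I, h) \<in> sos_families G f S" "sos_certificate G f \<alpha> I h"
      by (elim bexE) (simp split: prod.splits)
    have supp: "fourier_supp G (h i) \<subseteq> S" if "i \<in> I" for i
      using Ih(1) that by (auto simp: sos_families_def)
    have cert: "f g - \<alpha> = (\<Sum>i\<in>I. (cmod (h i g))\<^sup>2)" if "g \<in> carrier G" for g
      using Ih(2) that by (simp add: sos_certificate_def)
    let ?w = "\<lambda>i. fourier_coeff G (h i)"
    \<comment> \<open>The Gram matrix of the Fourier coefficients, cut off to lie in
      \<open>matrices_on S\<close>.\<close>
    define Q where "Q a b = (if a \<in> S \<and> b \<in> S then \<Sum>i\<in>I. cnj (?w i a) * ?w i b else 0)" for a b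
    have Q: "Q \<in> matrices_on S" "hermitian_psd_on S Q"
      by (simp add: Q_def matrices_on_def) (rule hermitian_psd_on_gram[where I = I and w = ?w], simp add: Q_def)
    have "complex_of_real (f g - \<alpha>) = (\<Sum>a\<in>S. \<Sum>b\<in>S. Q a b * (cnj (a g) * b g))"
      if g: "g \<in> carrier G" for g
    proof -
      have h: "h i g = (\<Sum>b\<in>S. ?w i b * b g)" if "i \<in> I" for i
      proof -
        have "h i g = (\<Sum>b\<in>?D. ?w i b * b g)"
          by (rule fourier_inversion[OF fin g, symmetric])
        also have "\<dots> = (\<Sum>b\<in>S. ?w i b * b g)"
          by (rule sum.mono_neutral_right)
             (use finD S supp[OF that] in \<open>auto simp: fourier_supp_def\<close>)
        finally show ?thesis .
      qed
      have "(\<Sum>a\<in>S. \<Sum>b\<in>S. Q a b * (cnj (a g) * b g))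
          = (\<Sum>a\<in>S. \<Sum>b\<in>S. (\<Sum>i\<in>I. cnj (?w i a) * ?w i b) * (cnj (a g) * b g))"
        by (intro sum.cong refl) (simp add: Q_def)
      also have "\<dots> = complex_of_real (\<Sum>i\<in>I. (cmod (\<Sum>b\<in>S. ?w i b * b g))\<^sup>2)"
        by (rule quadratic_form_gram)
      also have "(\<Sum>i\<in>I. (cmod (\<Sum>b\<in>S. ?w i b * b g))\<^sup>2) = f g - \<alpha>"
        unfolding cert[OF g] by (intro sum.cong refl) (simp only: h)
      finally show ?thesis by simp
    qed
    then show "\<exists>Q\<in>sdp_feasible G f S. sdp_objective G f S Q = complex_of_real \<alpha>"
      using sdp_solution_iff[OF fin S Q] by blast
  next
    assume "\<exists>Q\<in>sdp_feasible G f S. sdp_objective G f S Q = complex_of_real \<alpha>"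
    then obtain Q where opt: "Q \<in> sdp_feasible G f S \<and> sdp_objective G f S Q = complex_of_real \<alpha>"
      by blast
    then have Q: "Q \<in> matrices_on S" "hermitian_psd_on S Q"
      by (simp_all add: sdp_feasible_def)
    have finS: "finite S" using S finD by (rule finite_subset)
    obtain n :: nat and w where w: "\<And>a b. a \<in> S \<Longrightarrow> b \<in> S \<Longrightarrow> Q a b = (\<Sum>i<n. cnj (w i a) * w i b)"
      using hermitian_psd_on_decomposition[OF finS Q(2)] by blast
    \<comment> \<open>Each vector of the Gram decomposition is read as the Fourier coefficients of
      one function.\<close>
    define h where "h i g = (\<Sum>b\<in>S. w i b * b g)" for i g
    have "f g - \<alpha> = (\<Sum>i<n. (cmod (h i g))\<^sup>2)" if g: "g \<in> carrier G" for g
    proof -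
      have "complex_of_real (f g - \<alpha>) = (\<Sum>a\<in>S. \<Sum>b\<in>S. Q a b * (cnj (a g) * b g))"
        using sdp_solution_iff[OF fin S Q] opt g by blast
      also have "\<dots> = (\<Sum>a\<in>S. \<Sum>b\<in>S. (\<Sum>i<n. cnj (w i a) * w i b) * (cnj (a g) * b g))"
        by (intro sum.cong refl) (simp add: w)
      also have "\<dots> = complex_of_real (\<Sum>i<n. (cmod (h i g))\<^sup>2)"
        unfolding h_def by (rule quadratic_form_gram)
      finally show ?thesis by (simp only: of_real_eq_iff)
    qed
    then have cert: "sos_certificate G f \<alpha> {..<n} h"
      by (simp add: sos_certificate_def)
    \<comment> \<open>Padding the expansion of \<open>h i\<close> by zeros to the full dual group
      makes uniqueness applicable, which bounds the support.\<close>
    have "fourier_coeff G (h i) \<chi> = (if \<chi> \<in> S then w i \<chi> else 0)" if "\<chi> \<in> ?D" for i \<chi>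
    proof (rule fourier_coeff_unique[OF fin that])
      show "h i g = (\<Sum>\<chi>\<in>?D. (if \<chi> \<in> S then w i \<chi> else 0) * \<chi> g)" for g
        unfolding h_def by (rule sum.mono_neutral_cong_left) (use finD S in auto)
    qed
    then have "fourier_supp G (h i) \<subseteq> S" for i
      by (auto simp: fourier_supp_def split: if_splits)
    with cert have "({..<n}, h) \<in> sos_families G f S"
      by (auto simp: sos_families_def)
    with cert show "\<exists>(I, h)\<in>sos_families G f S. sos_certificate G f \<alpha> I h"
      by (intro bexI[of _ "({..<n}, h)"]) simp_all
  }
qed

end
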